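(* Let $\mathcal D$ be a doctrine on a finite set of literals $\Pi$, let $v$ be a valuation and let $p\in\Pi$ with $v_p<1$. Let $v_p$ grow while $v_\alpha$ is kept constant for every $\alpha\neq p$. Then the acceptability $v^*_p-v^*_{\overline p}$ of $p$ either increases or stays constant. Explicitly: for $t\in[v_p,1]$ let $\tilde v$ be the valuation with $\tilde v_p=t$ and $\tilde v_\alpha=v_\alpha$ for $\alpha\ne p$, and let $f(t)=\tilde v^*_p-\tilde v^*_{\overline p}$; then there exists $\delta>0$ with $v_p+\delta\le1$ such that either $f(t)>f(v_p)$ for all $t$ with $v_p<t\le v_p+\delta$, or $f(t)=f(v_p)$ for all $t$ with $v_p\le t\le v_p+\delta$.
   Context: $\Pi_+$ is a finite nonempty set of atoms; $\Pi=\bigcup_{p\in\Pi_+}\{p,\overline p\}$ is the set of literals, where $p\mapsto\overline p$ is negation and $\overline{\overline p}=p$ (so in particular $\overline p$ counts as a literal different from $p$). A clause is a subset $C\subseteq\Pi$, read as the disjunction $\bigvee_{p\in C}p$. A doctrine is a collection $\mathcal D$ of clauses, read as the conjunctive normal form $\bigwedge_{C\in\mathcal D}\bigvee_{p\in C}p$. Standing assumptions: (D1) this formula is satisfiable; (D2) no clause in $\mathcal D$ consists of a single literal; (D3) $\{p,\overline p\}\in\mathcal D$ for every $p\in\Pi_+$. A valuation is a map $w:\Pi\to[0,1]$, $p\mapsto w_p$ (no relation between $w_p$ and $w_{\overline p}$ is required). For a valuation $v$ define $v'$ by $$v'_p=\max_{C\in\mathcal D,\ C\ni p}\ \min_{\alpha\in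 C,\ \alpha\neq p} v_{\overline\alpha}.$$ Put $v^{(0)}=v$ and $v^{(n+1)}=(v^{(n)})'$. This sequence is non-decreasing and takes values in the finite set $\{v_\alpha:\alpha\in\Pi\}$, so it is eventually constant; its eventual value is the upper revised valuation $v^*$. *)

theory Defs
  imports Complex_Main
begin

datatype 'a literal = Pos 'a | Neg 'a

primrec neg :: "'a literal \<Rightarrow> 'a literal" where
  "neg (Pos a) = Neg a"
| "neg (Neg a) = Pos a"

definition literals :: "'a set \<Rightarrow> 'a literal set" where
  "literals A = Pos ` A \<union> Neg ` A"

primrec holds :: "('a \<Rightarrow> bool) \<Rightarrow> 'a literal \<Rightarrow> bool" where
  "holds \<tau> (Pos a) \<longleftrightarrow> \<tau> a"
| "holds \<tau> (Neg a) \<longleftrightarrow> \<not> \<tau> a"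

definition satisfiable :: "'a literal set set \<Rightarrow> bool" where
  "satisfiable D \<longleftrightarrow> (\<exists>\<tau>. \<forall>C\<in>D. \<exists>q\<in>C. holds \<tau> q)"

definition doctrine :: "'a set \<Rightarrow> 'a literal set set \<Rightarrow> bool" where
  "doctrine A D \<longleftrightarrow>
     finite A \<and> A \<noteq> {} \<and>
     (\<forall>C\<in>D. C \<subseteq> literals A) \<and>
     satisfiable D \<and>
     (\<forall>q. {q} \<notin> D) \<and>
     (\<forall>a\<in>A. {Pos a, Neg a} \<in> D)"

text \<open>Valuations are total functions; only their values on \<^term>\<open>literals A\<close> matter.\<close>

definition valuation :: "'a set \<Rightarrow> ('a literal \<Rightarrow> real) \<Rightarrow> bool" where
  "valuation A w \<longleftrightarrow> (\<forall>q\<in>literals A. 0 \<le> w q \<and> w q \<le> 1)"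

text \<open>For a doctrine and \<open>q\<close> in \<^term>\<open>literals A\<close>, both extrema range over finite nonempty sets:
  \<open>{q, neg q}\<close> is a clause containing \<open>q\<close>, and no clause is a singleton.\<close>

definition revise :: "'a literal set set \<Rightarrow> ('a literal \<Rightarrow> real) \<Rightarrow> 'a literal \<Rightarrow> real" where
  "revise D v q =
     Max ((\<lambda>C. Min ((\<lambda>\<alpha>. v (neg \<alpha>)) ` (C - {q}))) ` {C \<in> D. q \<in> C})"

text \<open>The eventual value of the sequence of iterated revisions; it exists for every
  doctrine, see \<open>eventually_upper_revised\<close> below.\<close>

definition upper_revised :: "'a literal set set \<Rightarrow> ('a literal \<Rightarrow> real) \<Rightarrow> 'a literal \<Rightarrow> real" where
  "upper_revised D v q = (THE x. \<forall>\<^sub>F n in sequentially. (revise D ^^ n) v q = x)"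

definition acceptability :: "'a literal set set \<Rightarrow> ('a literal \<Rightarrow> real) \<Rightarrow> 'a literal \<Rightarrow> real" where
  "acceptability D v q = upper_revised D v q - upper_revised D v (neg q)"

lemma neg_neg [simp]: "neg (neg q) = q"
  by (cases q) auto

lemma neg_neq [simp]: "neg q \<noteq> q"
  by (cases q) auto

lemma neg_in_literals [simp]: "neg q \<in> literals A \<longleftrightarrow> q \<in> literals A"
  by (cases q) (auto simp: literals_def)

lemma finite_literals: "finite A \<Longrightarrow> finite (literals A)"
  by (simp add: literals_def)

lemma doctrine_finite:
  assumes "doctrine A D"
  shows "finite D"
proof (rule finite_subset)
  show "D \<subseteq> Pow (literals A)" using assms by (auto simp: doctrine_def)
  show "finite (Pow (literals A))" using assms by (simp add: doctrine_def finite_literals)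
qed

lemma doctrine_excluded_middle:
  assumes "doctrine A D" "q \<in> literals A"
  shows "{q, neg q} \<in> D"
  using assms by (cases q) (auto simp: doctrine_def literals_def insert_commute)

lemma revise_ge:
  assumes "doctrine A D" "q \<in> literals A"
  shows "v q \<le> revise D v q"
proof -
  have "{q, neg q} - {q} = {neg q}" by auto
  then have "v q = Min ((\<lambda>\<alpha>. v (neg \<alpha>)) ` ({q, neg q} - {q}))" by simp
  also have "\<dots> \<le> revise D v q"
    unfolding revise_def
  proof (rule Max_ge)
    show "finite ((\<lambda>C. Min ((\<lambda>\<alpha>. v (neg \<alpha>)) ` (C - {q}))) ` {C \<in> D. q \<in> C})"
      using doctrine_finite[OF assms(1)] by simp
    show "Min ((\<lambda>\<alpha>. v (neg \<alpha>)) ` ({q, neg q} - {q})) \<in>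
        (\<lambda>C. Min ((\<lambda>\<alpha>. v (neg \<alpha>)) ` (C - {q}))) ` {C \<in> D. q \<in> C}"
      using doctrine_excluded_middle[OF assms] by (intro imageI) simp
  qed
  finally show ?thesis .
qed

lemma revise_in:
  assumes "doctrine A D" "q \<in> literals A"
  shows "revise D v q \<in> v ` literals A"
proof -
  let ?S = "(\<lambda>C. Min ((\<lambda>\<alpha>. v (neg \<alpha>)) ` (C - {q}))) ` {C \<in> D. q \<in> C}"
  have "revise D v q \<in> ?S"
    unfolding revise_def
    using doctrine_excluded_middle[OF assms] doctrine_finite[OF assms(1)]
    by (intro Max_in) auto
  then obtain C where C: "C \<in> D" "q \<in> C"
    and r: "revise D v q = Min ((\<lambda>\<alpha>. v (neg \<alpha>)) ` (C - {q}))" by auto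
  have sub: "C \<subseteq> literals A" and "C \<noteq> {q}" using C(1) assms(1) by (auto simp: doctrine_def)
  have "finite C" using sub assms(1) by (auto simp: doctrine_def finite_literals intro: finite_subset)
  moreover have "C - {q} \<noteq> {}" using C \<open>C \<noteq> {q}\<close> by auto
  ultimately have "revise D v q \<in> (\<lambda>\<alpha>. v (neg \<alpha>)) ` (C - {q})"
    unfolding r by (intro Min_in) auto
  then show ?thesis using sub by auto
qed

lemma eventually_upper_revised:
  assumes "doctrine A D" "q \<in> literals A"
  shows "\<forall>\<^sub>F n in sequentially. (revise D ^^ n) v q = upper_revised D v q"
proof -
  let ?s = "\<lambda>n. (revise D ^^ n) v q"
  have "?s n \<in> v ` literals A" for n
    using assms(2)
  proof (induction n arbitrary: q)
    case (Suc n)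
    then show ?case using revise_in[OF assms(1), of q "(revise D ^^ n) v"] by auto
  qed auto
  then have "range ?s \<subseteq> v ` literals A" by auto
  then have fin: "finite (range ?s)"
    using assms(1) by (meson doctrine_def finite_imageI finite_literals finite_subset)
  have inc: "incseq ?s"
    using revise_ge[OF assms] by (auto intro: incseq_SucI)
  have "Max (range ?s) \<in> range ?s" using fin by (intro Max_in) auto
  then obtain N where N: "Max (range ?s) = ?s N" by auto
  have ev: "\<forall>\<^sub>F n in sequentially. ?s n = ?s N"
    unfolding eventually_sequentially
  proof (intro exI allI impI)
    fix n assume "N \<le> n"
    then have "?s N \<le> ?s n" using inc by (simp add: incseq_def)
    moreover have "?s n \<le> ?s N" using Max_ge[OF fin, of "?s n"] N by auto
    ultimately show "?s n = ?s N" by simp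
  qed
  show ?thesis
    unfolding upper_revised_def
  proof (rule theI)
    show "\<forall>\<^sub>F n in sequentially. ?s n = ?s N" by (fact ev)
    fix x assume "\<forall>\<^sub>F n in sequentially. ?s n = x"
    with ev have "\<forall>\<^sub>F n in sequentially. x = ?s N" by eventually_elim simp
    then show "x = ?s N" by simp
  qed
qed

end

theory Submission
  imports Defs
begin

text \<open>Revision uses only \<open>max\<close> and \<open>min\<close>, so passing to the upper revised valuation commutes with
  every monotone map \<open>\<phi>\<close> of the values. Choose \<open>b > v p\<close> so close to \<open>v p\<close> that no \<open>v \<alpha>\<close> lies in
  the interval \<open>(v p, b]\<close>. The valuation in which \<open>p\<close> has value \<open>t \<in> [v p, b]\<close> arises from the one
  with value \<open>b\<close> by collapsing \<open>(v p, b]\<close> to \<open>t\<close>, so all these upper revised valuations are read off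
  from the single one at \<open>b\<close>. If its value \<open>P\<close> at \<open>p\<close> lies in the interval, the acceptability is
  \<open>t - t\<close> or \<open>t - Q\<close>, according to whether the value \<open>Q\<close> at \<open>neg p\<close> lies in it or not. Otherwise
  \<open>P > b\<close> is already the upper revised value of \<open>p\<close> under \<open>v\<close>, and raising \<open>v p\<close> below it changes
  nothing, since the upper revised valuation is the least fixed point above \<open>v\<close>.\<close>

lemma doctrine_clause_remainder:
  assumes "doctrine A D" "C \<in> D" "q \<in> C"
  shows "finite (C - {q})" "C - {q} \<noteq> {}" "C \<subseteq> literals A"
proof -
  show sub: "C \<subseteq> literals A" using assms by (auto simp: doctrine_def)
  then show "finite (C - {q})"
    using assms(1) by (auto simp: doctrine_def finite_literals intro: finite_subset)
  have "C \<noteq> {q}" using assms by (auto simp: doctrine_def)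
  then show "C - {q} \<noteq> {}" using assms(3) by auto
qed

lemma doctrine_clauses_containing:
  assumes "doctrine A D" "q \<in> literals A"
  shows "finite {C \<in> D. q \<in> C}" "{C \<in> D. q \<in> C} \<noteq> {}"
  using doctrine_finite[OF assms(1)] doctrine_excluded_middle[OF assms] by auto

text \<open>Taking \<open>x\<close> to be \<open>revise D u q\<close> itself yields a clause
  attaining the maximum, which reduces comparing revisions to comparing values literal by
  literal.\<close>

lemma le_revise_iff:
  assumes "doctrine A D" "q \<in> literals A"
  shows "x \<le> revise D v q \<longleftrightarrow> (\<exists>C\<in>D. q \<in> C \<and> (\<forall>\<alpha>\<in>C - {q}. x \<le> v (neg \<alpha>)))"
proof -
  have "x \<le> revise D v q \<longleftrightarrow>
      (\<exists>C\<in>{C \<in> D. q \<in> C}. x \<le> Min ((\<lambda>\<alpha>. v (neg \<alpha>)) ` (C - {q})))"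
    unfolding revise_def using doctrine_clauses_containing[OF assms] by (subst Max_ge_iff) auto
  also have "\<dots> \<longleftrightarrow> (\<exists>C\<in>{C \<in> D. q \<in> C}. \<forall>\<alpha>\<in>C - {q}. x \<le> v (neg \<alpha>))"
  proof (intro bex_cong refl)
    fix C assume "C \<in> {C \<in> D. q \<in> C}"
    then have "finite (C - {q})" "C - {q} \<noteq> {}"
      using doctrine_clause_remainder[OF assms(1)] by auto
    then show "x \<le> Min ((\<lambda>\<alpha>. v (neg \<alpha>)) ` (C - {q})) \<longleftrightarrow> (\<forall>\<alpha>\<in>C - {q}. x \<le> v (neg \<alpha>))"
      by (subst Min_ge_iff) auto
  qed
  finally show ?thesis by auto
qed

lemma revise_mono:
  assumes "doctrine A D" "\<And>q. q \<in> literals A \<Longrightarrow> u q \<le> w q" "q \<in> literals A"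
  shows "revise D u q \<le> revise D w q"
proof -
  obtain C where C: "C \<in> D" "q \<in> C" "\<forall>\<alpha>\<in>C - {q}. revise D u q \<le> u (neg \<alpha>)"
    using le_revise_iff[OF assms(1,3), of "revise D u q" u] by auto
  have "\<forall>\<alpha>\<in>C - {q}. revise D u q \<le> w (neg \<alpha>)"
  proof
    fix \<alpha> assume "\<alpha> \<in> C - {q}"
    then have "u (neg \<alpha>) \<le> w (neg \<alpha>)"
      using doctrine_clause_remainder(3)[OF assms(1) C(1,2)] assms(2) by auto
    then show "revise D u q \<le> w (neg \<alpha>)"
      using C(3) \<open>\<alpha> \<in> C - {q}\<close> by force
  qed
  then show ?thesis
    using le_revise_iff[OF assms(1,3)] C(1,2) by blast
qed

text \<open>Monotone maps commute with \<open>Min\<close> and \<open>Max\<close> of finite nonempty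
  sets. With \<open>\<phi> = id\<close> this also serves as a congruence rule: only values on
  \<open>literals A\<close> matter.\<close>

lemma revise_mono_map:
  assumes "doctrine A D" "mono \<phi>" "\<And>q. q \<in> literals A \<Longrightarrow> w q = \<phi> (u q)" "q \<in> literals A"
  shows "revise D w q = \<phi> (revise D u q)"
proof -
  have "Min ((\<lambda>\<alpha>. w (neg \<alpha>)) ` (C - {q})) = \<phi> (Min ((\<lambda>\<alpha>. u (neg \<alpha>)) ` (C - {q})))"
    if "C \<in> {C \<in> D. q \<in> C}" for C
  proof -
    have C: "finite (C - {q})" "C - {q} \<noteq> {}" "C \<subseteq> literals A"
      using that doctrine_clause_remainder[OF assms(1), of C q] by auto
    have "(\<lambda>\<alpha>. w (neg \<alpha>)) ` (C - {q}) = \<phi> ` (\<lambda>\<alpha>. u (neg \<alpha>)) ` (C - {q})"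
      unfolding image_image using C(3) by (intro image_cong refl assms(3)) auto
    then show ?thesis
      using mono_Min_commute[OF assms(2)] C(1,2) by simp
  qed
  then have "revise D w q =
      Max (\<phi> ` (\<lambda>C. Min ((\<lambda>\<alpha>. u (neg \<alpha>)) ` (C - {q}))) ` {C \<in> D. q \<in> C})"
    unfolding revise_def image_image by (intro arg_cong[where f = Max] image_cong refl)
  also have "\<dots> = \<phi> (revise D u q)"
    unfolding revise_def using doctrine_clauses_containing[OF assms(1,4)]
    by (intro mono_Max_commute[OF assms(2), symmetric]) auto
  finally show ?thesis .
qed

lemma upper_revised_witness:
  assumes "doctrine A D" "q \<in> literals A"
  obtains N where "\<And>n. N \<le> n \<Longrightarrow> (revise D ^^ n) v q = upper_revised D v q"
  using eventually_upper_revised[OF assms] unfolding eventually_sequentially by blast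

text \<open>The relation passes to all iterates by induction and is then read off at an index where
  both sequences have settled.\<close>

lemma upper_revised_mono_map:
  assumes "doctrine A D" "mono \<phi>" "\<And>q. q \<in> literals A \<Longrightarrow> w q = \<phi> (u q)" "q \<in> literals A"
  shows "upper_revised D w q = \<phi> (upper_revised D u q)"
proof -
  have iter: "(revise D ^^ n) w q = \<phi> ((revise D ^^ n) u q)" if "q \<in> literals A" for n q
    using that by (induction n arbitrary: q) (auto intro: assms(3) revise_mono_map[OF assms(1,2)])
  obtain M where M: "\<And>n. M \<le> n \<Longrightarrow> (revise D ^^ n) w q = upper_revised D w q"
    using upper_revised_witness[OF assms(1,4), where v = w] by blast
  obtain N where N: "\<And>n. N \<le> n \<Longrightarrow> (revise D ^^ n) u q = upper_revised D u q"
    using upper_revised_witness[OF assms(1,4), where v = u] by blast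
  show ?thesis
    using iter[OF assms(4), of "max M N"] by (simp add: M N)
qed

lemma upper_revised_mono:
  assumes "doctrine A D" "\<And>q. q \<in> literals A \<Longrightarrow> u q \<le> w q" "q \<in> literals A"
  shows "upper_revised D u q \<le> upper_revised D w q"
proof -
  have iter: "(revise D ^^ n) u q \<le> (revise D ^^ n) w q" if "q \<in> literals A" for n q
    using that by (induction n arbitrary: q) (auto intro: assms(2) revise_mono[OF assms(1)])
  obtain M where M: "\<And>n. M \<le> n \<Longrightarrow> (revise D ^^ n) w q = upper_revised D w q"
    using upper_revised_witness[OF assms(1,3), where v = w] by blast
  obtain N where N: "\<And>n. N \<le> n \<Longrightarrow> (revise D ^^ n) u q = upper_revised D u q"
    using upper_revised_witness[OF assms(1,3), where v = u] by blast
  show ?thesis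
    using iter[OF assms(3), of "max M N"] by (simp add: M N)
qed

lemma upper_revised_ge:
  assumes "doctrine A D" "q \<in> literals A"
  shows "v q \<le> upper_revised D v q"
proof -
  have "v q \<le> (revise D ^^ n) v q" for n
    using revise_ge[OF assms] by (induction n) (auto intro: order_trans)
  moreover obtain N where "\<And>n. N \<le> n \<Longrightarrow> (revise D ^^ n) v q = upper_revised D v q"
    using upper_revised_witness[OF assms, where v = v] by blast
  ultimately show ?thesis by (metis order_refl)
qed

text \<open>Since \<open>literals A\<close> is finite, one index \<open>N\<close> serves all
  literals at once, and one further revision changes nothing there.\<close>

lemma revise_upper_revised:
  assumes "doctrine A D" "q \<in> literals A"
  shows "revise D (upper_revised D v) q = upper_revised D v q"
proof -
  have "\<forall>\<^sub>F n in sequentially. \<forall>q\<in>literals A. (revise D ^^ n) v q = upper_revised D v q"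
    using assms(1) eventually_upper_revised[OF assms(1)]
    by (intro eventually_ball_finite) (auto simp: doctrine_def finite_literals)
  then obtain N where N: "\<And>n q. N \<le> n \<Longrightarrow> q \<in> literals A \<Longrightarrow>
      (revise D ^^ n) v q = upper_revised D v q"
    unfolding eventually_sequentially by blast
  have "revise D (upper_revised D v) q = revise D ((revise D ^^ N) v) q"
    using revise_mono_map[OF assms(1), of id "upper_revised D v" "(revise D ^^ N) v" q]
    by (simp add: N assms(2) monoI)
  also have "\<dots> = upper_revised D v q"
    using N[of "Suc N" q] assms(2) by simp
  finally show ?thesis .
qed

lemma upper_revised_idem:
  assumes "doctrine A D" "q \<in> literals A"
  shows "upper_revised D (upper_revised D v) q = upper_revised D v q"
proof -
  have "(revise D ^^ n) (upper_revised D v) q = upper_revised D v q" if "q \<in> literals A" for n q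
    using that
  proof (induction n arbitrary: q)
    case (Suc n)
    then have "revise D ((revise D ^^ n) (upper_revised D v)) q = revise D (upper_revised D v) q"
      using revise_mono_map[OF assms(1), of id "(revise D ^^ n) (upper_revised D v)"
          "upper_revised D v" q] by (simp add: monoI)
    then show ?case using revise_upper_revised[OF assms(1) Suc.prems] by simp
  qed simp
  then have "(revise D ^^ n) (upper_revised D v) q = upper_revised D v q" for n
    using assms(2) by blast
  moreover obtain N where "\<And>n. N \<le> n \<Longrightarrow>
      (revise D ^^ n) (upper_revised D v) q = upper_revised D (upper_revised D v) q"
    using upper_revised_witness[OF assms, where v = "upper_revised D v"] by blast
  ultimately show ?thesis by (metis order_refl)
qed

text \<open>Monotonicity bounds the upper revision of \<open>u\<close> by those of \<open>v\<close>
  and of \<open>upper_revised D v\<close>, and these two agree by idempotence.\<close>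

lemma upper_revised_squeeze:
  assumes "doctrine A D" "q \<in> literals A"
    and "\<And>q. q \<in> literals A \<Longrightarrow> v q \<le> u q"
    and "\<And>q. q \<in> literals A \<Longrightarrow> u q \<le> upper_revised D v q"
  shows "upper_revised D u q = upper_revised D v q"
proof (rule antisym)
  show "upper_revised D v q \<le> upper_revised D u q"
    using upper_revised_mono[OF assms(1), of v u q] assms(2,3) by simp
  show "upper_revised D u q \<le> upper_revised D v q"
    using upper_revised_mono[OF assms(1), of u "upper_revised D v" q]
      upper_revised_idem[OF assms(1,2), of v] assms(2,4) by simp
qed

lemma ex_gap_above:
  fixes S :: "real set"
  assumes "finite S" "a < c"
  obtains b where "a < b" "b \<le> c" "\<And>x. x \<in> S \<Longrightarrow> x \<le> a \<or> b < x"
proof -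
  \<comment> \<open>Inserting \<open>c\<close> keeps the set nonempty and caps \<open>m\<close>. The
    midpoint of \<open>a\<close> and \<open>m\<close> lies strictly below \<open>m\<close>, hence
    strictly below every element of \<open>S\<close> above \<open>a\<close>.\<close>
  define m where "m = Min (insert c {x \<in> S. a < x})"
  have fin: "finite (insert c {x \<in> S. a < x})" using assms(1) by simp
  have "a < m" unfolding m_def using fin assms(2) by (subst Min_gr_iff) auto
  then have "a < (a + m) / 2" "(a + m) / 2 < m" by simp_all
  moreover have "m \<le> c" "\<And>x. x \<in> S \<Longrightarrow> a < x \<Longrightarrow> m \<le> x"
    unfolding m_def using fin by (auto intro: Min_le)
  ultimately show thesis by (intro that[of "(a + m) / 2"]) force+
qed

theorem theorem3p14:
  fixes A :: "'a set" and D :: "'a literal set set"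
    and v :: "'a literal \<Rightarrow> real" and p :: "'a literal"
  assumes "doctrine A D"
    and "valuation A v"
    and "p \<in> literals A"
    and "v p < 1"
  shows "let f = (\<lambda>t::real. acceptability D (v(p := t)) p) in
    \<exists>\<delta>>0. v p + \<delta> \<le> 1 \<and>
      ((\<forall>t. v p < t \<and> t \<le> v p + \<delta> \<longrightarrow> f t > f (v p)) \<or>
       (\<forall>t. v p \<le> t \<and> t \<le> v p + \<delta> \<longrightarrow> f t = f (v p)))"
proof -
  define f where "f = (\<lambda>t::real. acceptability D (v(p := t)) p)"
  have fin: "finite (v ` literals A)" using assms(1) by (simp add: doctrine_def finite_literals)
  obtain b where b: "v p < b" "b \<le> 1"
    and gap: "\<And>x. x \<in> v ` literals A \<Longrightarrow> x \<le> v p \<or> b < x"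
    using ex_gap_above[OF fin assms(4)] by blast
  define \<psi> where "\<psi> = (\<lambda>t x::real. if v p < x \<and> x \<le> b then t else x)"
  define P where "P = upper_revised D (v(p := b)) p"
  define Q where "Q = upper_revised D (v(p := b)) (neg p)"
  have revised: "upper_revised D (v(p := t)) q = \<psi> t (upper_revised D (v(p := b)) q)"
    if "v p \<le> t" "t \<le> b" "q \<in> literals A" for t q
  proof (rule upper_revised_mono_map[OF assms(1) _ _ that(3)])
    \<comment> \<open>Order is kept because \<open>t\<close> lies between the untouched values,
      which are at most \<open>v p\<close> or exceed \<open>b\<close>.\<close>
    show "mono (\<psi> t)" using that by (auto simp: mono_def \<psi>_def)
    \<comment> \<open>At \<open>p\<close> the value \<open>b\<close> collapses to \<open>t\<close>;
      elsewhere the gap puts \<open>v r\<close> outside the interval, where \<open>\<psi> t\<close>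
      is the identity.\<close>
    show "(v(p := t)) r = \<psi> t ((v(p := b)) r)" if "r \<in> literals A" for r
      using gap[of "v r"] that b by (auto simp: \<psi>_def)
  qed
  have f: "f t = \<psi> t P - \<psi> t Q" if "v p \<le> t" "t \<le> b" for t
    unfolding f_def acceptability_def P_def Q_def
    using revised[OF that, of p] revised[OF that, of "neg p"] assms(3) by simp
  have "b \<le> P"
    using upper_revised_ge[OF assms(1,3), of "v(p := b)"] by (simp add: P_def)
  \<comment> \<open>As \<open>b \<le> P\<close>, the value \<open>P\<close> can lie in the interval
    only as \<open>b\<close>. The three cases make \<open>f\<close> zero, strictly increasing and
    constant.\<close>
  then consider "P = b" "v p < Q" "Q \<le> b" | "P = b" "Q \<le> v p \<or> b < Q" | "b < P"
    by linarith
  then have "(\<forall>t. v p < t \<and> t \<le> b \<longrightarrow> f t > f (v p)) \<or> (\<forall>t. v p \<le> t \<and> t \<le> b \<longrightarrow> f t = f (v p))"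
  proof cases
    case 1
    then show ?thesis using b f by (auto simp: \<psi>_def)
  next
    case 2
    then show ?thesis using b f by (auto simp: \<psi>_def)
  next
    case 3
    have "upper_revised D v p = \<psi> (v p) P"
      using revised[of "v p" p] b assms(3) by (simp add: P_def)
    then have vP: "upper_revised D v p = P" using 3 by (simp add: \<psi>_def)
    \<comment> \<open>The formula for \<open>f\<close> alone would allow a decrease here if
      \<open>Q\<close> lay in the interval. Squeezing excludes this: \<open>t \<le> b < P\<close>
      keeps \<open>v(p := t)\<close> between \<open>v\<close> and
      \<open>upper_revised D v\<close>.\<close>
    have "upper_revised D (v(p := t)) q = upper_revised D v q"
      if "v p \<le> t" "t \<le> b" "q \<in> literals A" for t q
      using that 3 vP upper_revised_ge[OF assms(1), of _ v]
      by (intro upper_revised_squeeze[OF assms(1)]) auto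
    then show ?thesis
      unfolding f_def acceptability_def using b assms(3) by simp
  qed
  then show ?thesis
    unfolding Let_def f_def using b by (intro exI[of _ "b - v p"]) simp
qed

end
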